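(* Consider the scalar system $$x_{k+1}=\tfrac32x_k+u_k,\qquad|u_k|\le1,\qquad x_0\sim\mathrm{Unif}[-1,1],$$ and for $\beta\in(0,1]$ the cost $J_\beta(\pi)=\mathbb{E}\sum_{k=0}^\infty\beta^kx_k^2$ of a controller $\pi$. Let $\mathcal{C}_{\rm dyn}$ be the class of admissible finite-dimensional LTI dynamic controllers defined in the context. Then for every $\beta\in(0,1]$: (i) every controller in $\mathcal{C}_{\rm dyn}$ satisfies $J_\beta\ge\frac13+\frac{\beta}{12}$; (ii) the static two-ReLU controller $$u=1-\sigma\!\left(\tfrac32x+1\right)+\sigma\!\left(\tfrac32x-1\right)=-\mathrm{sat}\!\left(\tfrac32x\right)$$ satisfies $|u|\le1$ and has cost $J_\beta^{\rm NN}=\frac13+\frac{\beta}{36}$; (iii) therefore $J_\beta^{\rm NN}<\inf_{\pi\in\mathcal{C}_{\rm dyn}}J_\beta(\pi)$, and the gap is at least $\beta/18$.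
   Context: $\sigma(r)=\max\{0,r\}$ and $\mathrm{sat}(r)=\max\{-1,\min\{r,1\}\}$. The class $\mathcal{C}_{\rm dyn}$ consists of all finite-dimensional LTI dynamic controllers (of any order) $$\xi_{k+1}=A_c\xi_k+B_cx_k,\qquad u_k=C_c\xi_k+D_cx_k,$$ with a fixed initial controller state $\xi_0$ independent of $x_0$, such that in closed loop $|u_k|\le1$ for all $k\ge0$ and all $x_0\in[-1,1]$. Costs take values in $[0,+\infty]$. *)

theory Defs
  imports "HOL-Probability.Probability" "Jordan_Normal_Form.Matrix"
begin

text \<open>A causal time-invariant controller with internal state space \<open>'s\<close>: from the current
  controller state and the measured plant state it produces the input and the next controller
  state.  The initial controller state is a constant, hence independent of \<open>x0\<close>.\<close>

record 's controller =
  ctrl_init :: 's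
  ctrl_next :: "'s \<Rightarrow> real \<Rightarrow> 's"
  ctrl_out :: "'s \<Rightarrow> real \<Rightarrow> real"

primrec closed_loop :: "'s controller \<Rightarrow> real \<Rightarrow> nat \<Rightarrow> real \<times> 's" where
  "closed_loop \<pi> x0 0 = (x0, ctrl_init \<pi>)"
| "closed_loop \<pi> x0 (Suc k) =
     (let (x, \<xi>) = closed_loop \<pi> x0 k
      in (3/2 * x + ctrl_out \<pi> \<xi> x, ctrl_next \<pi> \<xi> x))"

definition plant_state :: "'s controller \<Rightarrow> real \<Rightarrow> nat \<Rightarrow> real" where
  "plant_state \<pi> x0 k = fst (closed_loop \<pi> x0 k)"

definition plant_input :: "'s controller \<Rightarrow> real \<Rightarrow> nat \<Rightarrow> real" where
  "plant_input \<pi> x0 k = (let (x, \<xi>) = closed_loop \<pi> x0 k in ctrl_out \<pi> \<xi> x)"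

definition admissible :: "'s controller \<Rightarrow> bool" where
  "admissible \<pi> \<longleftrightarrow> (\<forall>x0\<in>{-1..1}. \<forall>k. \<bar>plant_input \<pi> x0 k\<bar> \<le> 1)"

definition cost :: "real \<Rightarrow> 's controller \<Rightarrow> ennreal" where
  "cost \<beta> \<pi> =
     (\<integral>\<^sup>+ x0. (\<Sum>k. ennreal (\<beta> ^ k * (plant_state \<pi> x0 k)\<^sup>2))
        \<partial>uniform_measure lborel {-1..1})"

text \<open>The plant is scalar, so the \<open>n \<times> 1\<close> matrix \<open>B\<close> and the \<open>1 \<times> n\<close> matrix \<open>C\<close> are
  represented as vectors of dimension \<open>n\<close>, and \<open>D\<close> as a real number.\<close>

definition lti_controller ::
  "real mat \<Rightarrow> real vec \<Rightarrow> real vec \<Rightarrow> real \<Rightarrow> real vec \<Rightarrow> real vec controller" where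
  "lti_controller A B C D \<xi>0 =
     \<lparr> ctrl_init = \<xi>0,
       ctrl_next = (\<lambda>\<xi> x. A *\<^sub>v \<xi> + x \<cdot>\<^sub>v B),
       ctrl_out = (\<lambda>\<xi> x. scalar_prod C \<xi> + D * x) \<rparr>"

text \<open>The order \<open>n\<close> is arbitrary; \<open>n = 0\<close> gives the static linear feedbacks.\<close>

definition C_dyn :: "real vec controller set" where
  "C_dyn = {lti_controller A B C D \<xi>0 | n A B C D \<xi>0.
     A \<in> carrier_mat n n \<and> B \<in> carrier_vec n \<and> C \<in> carrier_vec n \<and> \<xi>0 \<in> carrier_vec n \<and>
     admissible (lti_controller A B C D \<xi>0)}"

definition static_controller :: "(real \<Rightarrow> real) \<Rightarrow> unit controller" where
  "static_controller f =
     \<lparr> ctrl_init = (), ctrl_next = (\<lambda>_ _. ()), ctrl_out = (\<lambda>_ x. f x) \<rparr>"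

definition relu :: "real \<Rightarrow> real" where
  "relu r = max 0 r"

definition sat :: "real \<Rightarrow> real" where
  "sat r = max (-1) (min r 1)"

definition two_relu :: "real \<Rightarrow> real" where
  "two_relu x = 1 - relu (3/2 * x + 1) + relu (3/2 * x - 1)"

end

theory Submission
  imports Defs
begin

text \<open>An admissible LTI controller acts at time \<open>0\<close> by an affine map \<open>u0 = D * x0 + b\<close>, and
  \<open>\<bar>u0\<bar> \<le> 1\<close> on \<open>[-1, 1]\<close> forces \<open>\<bar>D\<bar> \<le> 1\<close>.  Hence the slope \<open>3/2 + D\<close> of \<open>x1\<close> is at least
  \<open>1/2\<close>, and already the first two terms of the cost give the lower bound.  Under the saturated
  feedback \<open>x1\<close> vanishes for \<open>\<bar>x0\<bar> \<le> 2/3\<close> and has modulus \<open>3/2 * \<bar>x0\<bar> - 1 \<le> 1/2\<close> otherwise, so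
  that \<open>x2 = 0\<close> and the cost consists of its first two terms only.\<close>

lemma nn_integral_uniform_symmetric_Icc:
  fixes f :: "real \<Rightarrow> ennreal"
  assumes "f \<in> borel_measurable borel"
  shows "(\<integral>\<^sup>+x. f x \<partial>uniform_measure lborel {-1..1})
    = (\<integral>\<^sup>+x. f x * indicator {-1..1} x \<partial>lborel) / 2"
  using assms by (subst nn_integral_uniform_measure) auto

lemma ennreal_double_divide_2: "ennreal (2 * r) / 2 = ennreal r" if "0 \<le> r"
  using divide_ennreal[of "2 * r" 2] that by simp

lemma two_relu_eq_sat: "two_relu x = - sat (3/2 * x)"
  by (auto simp: two_relu_def sat_def relu_def max_def min_def)

lemma abs_two_relu_le_1: "\<bar>two_relu x\<bar> \<le> 1"
  by (auto simp: two_relu_eq_sat sat_def)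

lemma plant_state_0: "plant_state \<pi> x 0 = x"
  by (simp add: plant_state_def)

lemma plant_state_1: "plant_state \<pi> x (Suc 0) = 3/2 * x + ctrl_out \<pi> (ctrl_init \<pi>) x"
  by (simp add: plant_state_def)

lemma plant_state_static_Suc:
  "plant_state (static_controller f) x (Suc k) =
     3/2 * plant_state (static_controller f) x k + f (plant_state (static_controller f) x k)"
  by (simp add: plant_state_def static_controller_def split: prod.split)

text \<open>The series has nonnegative terms, so a partial sum bounds it pointwise. Monotonicity of
  \<open>nn_integral\<close> holds for arbitrary integrands, so this applies to any
  \<open>\<pi>\<close>.\<close>

lemma cost_ge_two_terms:
  assumes "0 \<le> \<beta>"
  shows "(\<integral>\<^sup>+x. ennreal (x\<^sup>2 + \<beta> * (plant_state \<pi> x (Suc 0))\<^sup>2)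
           \<partial>uniform_measure lborel {-1..1}) \<le> cost \<beta> \<pi>"
  unfolding cost_def
proof (rule nn_integral_mono)
  fix x :: real
  have "ennreal (x\<^sup>2 + \<beta> * (plant_state \<pi> x (Suc 0))\<^sup>2)
    = (\<Sum>k<2. ennreal (\<beta> ^ k * (plant_state \<pi> x k)\<^sup>2))"
    using assms by (simp add: numeral_2_eq_2 plant_state_0 ennreal_plus)
  also have "\<dots> \<le> (\<Sum>k. ennreal (\<beta> ^ k * (plant_state \<pi> x k)\<^sup>2))"
    by (rule sum_le_suminf) auto
  finally show "ennreal (x\<^sup>2 + \<beta> * (plant_state \<pi> x (Suc 0))\<^sup>2)
    \<le> (\<Sum>k. ennreal (\<beta> ^ k * (plant_state \<pi> x k)\<^sup>2))" .
qed

text \<open>Under the uniform law \<open>x\<close> has mean 0 and second moment 1/3, so the cross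
  term of the square averages out.\<close>

lemma nn_integral_affine_two_terms:
  fixes \<beta> p b :: real
  assumes "0 \<le> \<beta>"
  shows "(\<integral>\<^sup>+x. ennreal (x\<^sup>2 + \<beta> * (p * x + b)\<^sup>2) \<partial>uniform_measure lborel {-1..1})
    = ennreal (1/3 + \<beta> * (p\<^sup>2 / 3 + b\<^sup>2))"
proof -
  \<comment> \<open>The square is integrated in expanded form:
    \<open>(p * x + b)^3 / (3 * p)\<close> would fail at \<open>p = 0\<close>.\<close>
  let ?F = "\<lambda>x::real. x^3/3 + \<beta> * (p\<^sup>2 * x^3/3 + p * b * x\<^sup>2 + b\<^sup>2 * x)"
  have "(\<integral>\<^sup>+x. ennreal (x\<^sup>2 + \<beta> * (p * x + b)\<^sup>2) * indicator {-1..1} x \<partial>lborel)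
    = ennreal (?F 1 - ?F (-1))"
  proof (rule nn_integral_FTC_Icc)
    fix x :: real
    show "DERIV ?F x :> x\<^sup>2 + \<beta> * (p * x + b)\<^sup>2"
      by (auto intro!: derivative_eq_intros simp: field_simps power2_eq_square)
  qed (use assms in auto)
  also have "?F 1 - ?F (-1) = 2 * (1/3 + \<beta> * (p\<^sup>2 / 3 + b\<^sup>2))"
    by (simp add: field_simps)
  also have "ennreal \<dots> / 2 = ennreal (1/3 + \<beta> * (p\<^sup>2 / 3 + b\<^sup>2))"
    using assms by (intro ennreal_double_divide_2) auto
  finally show ?thesis
    by (subst nn_integral_uniform_symmetric_Icc) auto
qed

lemma C_dyn_cost_ge:
  assumes "0 \<le> \<beta>" and "\<pi> \<in> C_dyn"
  shows "ennreal (1/3 + \<beta>/12) \<le> cost \<beta> \<pi>"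
proof -
  from assms(2) obtain A B C D \<xi>0 where
    \<pi>: "\<pi> = lti_controller A B C D \<xi>0" and adm: "admissible \<pi>"
    by (auto simp: C_dyn_def)
  define b where "b = scalar_prod C \<xi>0"
  have out: "ctrl_out \<pi> (ctrl_init \<pi>) x = D * x + b" for x
    by (simp add: \<pi> lti_controller_def b_def)
  have bound: "\<bar>D * x + b\<bar> \<le> 1" if "x \<in> {-1..1}" for x
    using adm that out[of x] unfolding admissible_def plant_input_def
    by (auto dest!: bspec[of _ _ x] spec[of _ 0])
  \<comment> \<open>The endpoints give \<open>D + b \<ge> -1\<close> and
    \<open>- D + b \<le> 1\<close>; subtracting eliminates \<open>b\<close>.\<close>
  have "- 1 \<le> D"
    using bound[of 1] bound[of "-1"] by simp
  then have "(1/2)\<^sup>2 \<le> (3/2 + D)\<^sup>2"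
    by (intro power_mono) auto
  \<comment> \<open>1/12 is a third of \<open>(1/2)\<^sup>2\<close>; the offset \<open>b\<close> can
    only raise the cost.\<close>
  then have "1/12 \<le> (3/2 + D)\<^sup>2 / 3 + b\<^sup>2"
    using zero_le_power2[of b] unfolding power2_eq_square[of "1/2"] by linarith
  then have "\<beta> * (1/12) \<le> \<beta> * ((3/2 + D)\<^sup>2 / 3 + b\<^sup>2)"
    using assms(1) by (rule mult_left_mono)
  then have "ennreal (1/3 + \<beta>/12) \<le> ennreal (1/3 + \<beta> * ((3/2 + D)\<^sup>2 / 3 + b\<^sup>2))"
    by (intro ennreal_leI) simp
  also have "\<dots> = (\<integral>\<^sup>+x. ennreal (x\<^sup>2 + \<beta> * (plant_state \<pi> x (Suc 0))\<^sup>2)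
           \<partial>uniform_measure lborel {-1..1})"
    unfolding nn_integral_affine_two_terms[OF assms(1), symmetric] plant_state_1 out
    by (simp only: distrib_right add.assoc)
  also have "\<dots> \<le> cost \<beta> \<pi>"
    by (rule cost_ge_two_terms) (use assms(1) in auto)
  finally show ?thesis .
qed

text \<open>After one step the state has modulus at most 1/2, inside the zone of modulus at most 2/3
  where the input cancels \<open>3/2 * x\<close> exactly. From then on \<open>sat 0 = 0\<close>
  keeps it at the origin.\<close>

lemma plant_state_two_relu_eq_0:
  assumes "x \<in> {-1..1}"
  shows "plant_state (static_controller two_relu) x (Suc (Suc k)) = 0"
proof (induction k)
  case 0
  show ?case
    using assms
    by (auto simp: plant_state_static_Suc plant_state_0 two_relu_eq_sat sat_def max_def min_def)
next
  case (Suc k)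
  then show ?case
    by (simp add: plant_state_static_Suc[of _ _ "Suc (Suc k)"] two_relu_eq_sat sat_def)
qed

lemma cost_two_relu:
  assumes "0 \<le> \<beta>"
  shows "cost \<beta> (static_controller two_relu) = ennreal (1/3 + \<beta>/36)"
proof -
  let ?s = "\<lambda>x::real. 3/2 * x + two_relu x"
  let ?g = "\<lambda>x::real. \<beta> * (3/2 * x - 1)\<^sup>2" and ?h = "\<lambda>x::real. \<beta> * (3/2 * x + 1)\<^sup>2"
  have meas [measurable]: "two_relu \<in> borel_measurable borel"
    unfolding two_relu_def[abs_def] relu_def by measurable
  have "cost \<beta> (static_controller two_relu)
    = (\<integral>\<^sup>+x. ennreal (x\<^sup>2 + \<beta> * (?s x)\<^sup>2) \<partial>uniform_measure lborel {-1..1})"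
    unfolding cost_def
  proof (rule nn_integral_cong_AE, rule AE_uniform_measureI)
    \<comment> \<open>The series collapses to two terms only for starts in [-1, 1]; from starts
      beyond 2 in modulus the loop diverges. Hence equality almost everywhere under the uniform
      law.\<close>
    show "AE x in lborel. x \<in> {-1..1} \<longrightarrow>
      (\<Sum>k. ennreal (\<beta> ^ k * (plant_state (static_controller two_relu) x k)\<^sup>2))
        = ennreal (x\<^sup>2 + \<beta> * (?s x)\<^sup>2)"
    proof (intro AE_I2 impI)
      fix x :: real
      assume x: "x \<in> {-1..1}"
      have "plant_state (static_controller two_relu) x k = 0" if "k \<notin> {..<2}" for k
        using plant_state_two_relu_eq_0[OF x, of "k - 2"] that
        by (simp add: numeral_2_eq_2 Suc_diff_Suc)
      then have "(\<Sum>k. ennreal (\<beta> ^ k * (plant_state (static_controller two_relu) x k)\<^sup>2))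
        = (\<Sum>k<2. ennreal (\<beta> ^ k * (plant_state (static_controller two_relu) x k)\<^sup>2))"
        by (intro suminf_finite) auto
      then show "(\<Sum>k. ennreal (\<beta> ^ k * (plant_state (static_controller two_relu) x k)\<^sup>2))
        = ennreal (x\<^sup>2 + \<beta> * (?s x)\<^sup>2)"
        using assms
        by (simp add: numeral_2_eq_2 plant_state_static_Suc plant_state_0 ennreal_plus)
    qed
  qed auto
  also have "\<dots> = (\<integral>\<^sup>+x. ennreal (x\<^sup>2 + \<beta> * (?s x)\<^sup>2) * indicator {-1..1} x \<partial>lborel) / 2"
    by (rule nn_integral_uniform_symmetric_Icc) measurable
  \<comment> \<open>\<open>?s\<close> vanishes between -2/3 and 2/3, which leaves one polynomial on
    each saturated tail. Both polynomials are zero at the breakpoints, so closed intervals do no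
    harm.\<close>
  also have "(\<integral>\<^sup>+x. ennreal (x\<^sup>2 + \<beta> * (?s x)\<^sup>2) * indicator {-1..1} x \<partial>lborel)
    = (\<integral>\<^sup>+x. ennreal (x\<^sup>2) * indicator {-1..1} x + (ennreal (?g x) * indicator {2/3..1} x
         + ennreal (?h x) * indicator {-1..-2/3} x) \<partial>lborel)"
  proof (rule nn_integral_cong)
    fix x :: real
    consider "x < -1" | "-1 \<le> x" "x \<le> -2/3" | "-2/3 < x" "x < 2/3" | "2/3 \<le> x" "x \<le> 1" | "1 < x"
      by linarith
    then show "ennreal (x\<^sup>2 + \<beta> * (?s x)\<^sup>2) * indicator {-1..1} x
      = ennreal (x\<^sup>2) * indicator {-1..1} x + (ennreal (?g x) * indicator {2/3..1} x
         + ennreal (?h x) * indicator {-1..-2/3} x)"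
      using assms by cases (auto simp: two_relu_def relu_def ennreal_plus)
  qed
  also have "\<dots> = (\<integral>\<^sup>+x. ennreal (x\<^sup>2) * indicator {-1..1} x \<partial>lborel)
    + ((\<integral>\<^sup>+x. ennreal (?g x) * indicator {2/3..1} x \<partial>lborel)
      + (\<integral>\<^sup>+x. ennreal (?h x) * indicator {-1..-2/3} x \<partial>lborel))"
    by (subst nn_integral_add; (subst nn_integral_add)?) auto
  also have "(\<integral>\<^sup>+x. ennreal (x\<^sup>2) * indicator {-1..1} x \<partial>lborel)
    = ennreal (1^3/3 - (-1)^3/3)"
    by (intro nn_integral_FTC_Icc[where F = "\<lambda>x. x^3/3"])
       (auto intro!: derivative_eq_intros)
  \<comment> \<open>The factor 2/9 is 1/3 divided by the inner slope 3/2. Each tail contributes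
    \<open>\<beta> * (2/9) * (1/2)^3 = \<beta>/36\<close>.\<close>
  also have "(\<integral>\<^sup>+x. ennreal (?g x) * indicator {2/3..1} x \<partial>lborel)
    = ennreal (\<beta> * (2/9 * (3/2 * 1 - 1)^3) - \<beta> * (2/9 * (3/2 * (2/3) - 1)^3))"
    using assms
    by (intro nn_integral_FTC_Icc[where F = "\<lambda>x. \<beta> * (2/9 * (3/2 * x - 1)^3)"])
       (auto intro!: derivative_eq_intros)
  also have "(\<integral>\<^sup>+x. ennreal (?h x) * indicator {-1..-2/3} x \<partial>lborel)
    = ennreal (\<beta> * (2/9 * (3/2 * (-2/3) + 1)^3) - \<beta> * (2/9 * (3/2 * (-1) + 1)^3))"
    using assms
    by (intro nn_integral_FTC_Icc[where F = "\<lambda>x. \<beta> * (2/9 * (3/2 * x + 1)^3)"])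
       (auto intro!: derivative_eq_intros)
  also have "ennreal (1^3/3 - (-1)^3/3)
      + (ennreal (\<beta> * (2/9 * (3/2 * 1 - 1)^3) - \<beta> * (2/9 * (3/2 * (2/3) - 1)^3))
       + ennreal (\<beta> * (2/9 * (3/2 * (-2/3) + 1)^3) - \<beta> * (2/9 * (3/2 * (-1) + 1)^3)))
    = ennreal (2 * (1/3 + \<beta>/36))"
    using assms by (simp add: power3_eq_cube flip: ennreal_plus)
  also have "\<dots> / 2 = ennreal (1/3 + \<beta>/36)"
    using assms by (intro ennreal_double_divide_2) auto
  finally show ?thesis .
qed

theorem theorem6:
  fixes \<beta> :: real
  assumes "0 < \<beta>" and "\<beta> \<le> 1"
  shows "(\<forall>\<pi>\<in>C_dyn. cost \<beta> \<pi> \<ge> ennreal (1/3 + \<beta>/12)) \<and>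
    ((\<forall>x. two_relu x = - sat (3/2 * x)) \<and>
     (\<forall>x. \<bar>two_relu x\<bar> \<le> 1) \<and>
     cost \<beta> (static_controller two_relu) = ennreal (1/3 + \<beta>/36)) \<and>
    (cost \<beta> (static_controller two_relu) < (INF \<pi>\<in>C_dyn. cost \<beta> \<pi>) \<and>
     (INF \<pi>\<in>C_dyn. cost \<beta> \<pi>) - cost \<beta> (static_controller two_relu) \<ge> ennreal (\<beta>/18))"
proof -
  let ?I = "INF \<pi>\<in>C_dyn. cost \<beta> \<pi>"
  have lower: "\<forall>\<pi>\<in>C_dyn. cost \<beta> \<pi> \<ge> ennreal (1/3 + \<beta>/12)"
    using assms C_dyn_cost_ge by simp
  then have inf: "ennreal (1/3 + \<beta>/12) \<le> ?I"
    by (intro INF_greatest) auto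
  have nn: "cost \<beta> (static_controller two_relu) = ennreal (1/3 + \<beta>/36)"
    using assms by (intro cost_two_relu) simp
  have "ennreal (1/3 + \<beta>/36) < ennreal (1/3 + \<beta>/12)"
    using assms by (intro ennreal_lessI) auto
  also note inf
  finally have less: "cost \<beta> (static_controller two_relu) < ?I"
    by (simp only: nn)
  \<comment> \<open>Subtraction in \<open>ennreal\<close> is monotone in its first argument, so the
    bound on \<open>?I\<close> carries over, even if \<open>?I\<close> were infinite.\<close>
  have "ennreal (\<beta>/18) = ennreal (1/3 + \<beta>/12) - ennreal (1/3 + \<beta>/36)"
    using assms by (subst ennreal_minus) auto
  also have "\<dots> \<le> ?I - cost \<beta> (static_controller two_relu)"
    unfolding nn by (intro ennreal_minus_mono inf order_refl)
  finally have gap: "ennreal (\<beta>/18) \<le> ?I - cost \<beta> (static_controller two_relu)" .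
  show ?thesis
    using lower nn less gap two_relu_eq_sat abs_two_relu_le_1 by blast
qed

end
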